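(* Let $G$ be a group such that $G/Z(G)$ is finitely generated, and let $i \geq 1$ be an integer. Then $\gamma_{i+1}(G)$ is finite if and only if $G/Z_i(G)$ is finite.
   Context: For a group $G$, $Z(G)$ denotes the center of $G$. The lower central series is indexed by $\gamma_1(G) = G$ and $\gamma_{k+1}(G) = [\gamma_k(G), G]$ for $k \geq 1$. The upper central series is indexed by $Z_0(G) = 1$ and $Z_{k+1}(G)/Z_k(G) = Z(G/Z_k(G))$ for $k \geq 0$, so $Z_1(G) = Z(G)$. *)

theory Defs
  imports "HOL-Algebra.Algebra"
begin

definition center :: "('a, 'b) monoid_scheme \<Rightarrow> 'a set" where
  "center G = {z \<in> carrier G. \<forall>x \<in> carrier G. z \<otimes>\<^bsub>G\<^esub> x = x \<otimes>\<^bsub>G\<^esub> z}"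

definition finitely_generated :: "('a, 'b) monoid_scheme \<Rightarrow> bool" where
  "finitely_generated G \<longleftrightarrow> (\<exists>S. finite S \<and> S \<subseteq> carrier G \<and> generate G S = carrier G)"

(* The convention for the commutator of h and k is the one of derived_set. *)
definition commutator_subgroup :: "('a, 'b) monoid_scheme \<Rightarrow> 'a set \<Rightarrow> 'a set \<Rightarrow> 'a set" where
  "commutator_subgroup G H K =
     generate G (\<Union>h \<in> H. \<Union>k \<in> K. {h \<otimes>\<^bsub>G\<^esub> k \<otimes>\<^bsub>G\<^esub> inv\<^bsub>G\<^esub> h \<otimes>\<^bsub>G\<^esub> inv\<^bsub>G\<^esub> k})"

(* The lower central series starts at index 1; the value at index 0 is a dummy. *)
fun lower_central :: "('a, 'b) monoid_scheme \<Rightarrow> nat \<Rightarrow> 'a set" where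
  "lower_central G 0 = carrier G"
| "lower_central G (Suc 0) = carrier G"
| "lower_central G (Suc (Suc k)) = commutator_subgroup G (lower_central G (Suc k)) (carrier G)"

(* The next term is the preimage of the center of the quotient by the current one. *)
primrec upper_central :: "('a, 'b) monoid_scheme \<Rightarrow> nat \<Rightarrow> 'a set" where
  "upper_central G 0 = {\<one>\<^bsub>G\<^esub>}"
| "upper_central G (Suc k) =
     {x \<in> carrier G. upper_central G k #>\<^bsub>G\<^esub> x \<in> center (G Mod upper_central G k)}"

lemma upper_central_Suc_quotient:
  "carrier (G\<lparr>carrier := upper_central G (Suc k)\<rparr> Mod upper_central G k)
     = center (G Mod upper_central G k)"
  by (auto simp: carrier_FactGroup center_def r_coset_def)

lemma commutator_subgroup_self: "commutator_subgroup G H H = derived G H"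
  by (simp add: commutator_subgroup_def derived_def)

lemma (in group) upper_central_1: "upper_central G 1 = center G"
  by (auto simp: carrier_FactGroup center_def r_coset_def set_mult_def)

end

theory Submission
  imports Defs
begin

text \<open>
  Write $P(j,k)$ for the assertion that $\gamma_j(G)$ has finite image in $G/Z_k(G)$. The theorem
  is the equivalence of $P(i+1,0)$ and $P(1,i)$, and both directions walk along $j+k=i+1$.

  From $P(j+1,k)$ to $P(j,k+1)$: let $S$ be a finite set generating $G$ modulo its center. Modulo
  $Z_k(G)$ there are finitely many tuples $([x,s])_{s\in S}$ with $x\in\gamma_j(G)$, and two
  elements with the same tuple induce the same conjugation on $G/Z_k(G)$, so they agree modulo
  $Z_{k+1}(G)$.

  From $P(j,k+1)$ to $P(j+1,k)$ when $G/Z_{j+k}(G)$ is finite: since $[\gamma_j(G),Z_{j+k}(G)]\le Z_k(G)$,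
  the commutator of $x\in\gamma_j(G)$ and $g\in G$ modulo $Z_k(G)$ depends only on $x$ modulo
  $Z_{k+1}(G)$ and $g$ modulo $Z_{j+k}(G)$, so there are finitely many of them, and each has a power
  that is central in $G/Z_k(G)$. As in the proof of Schur's theorem, they generate a finite group.
\<close>

section \<open>Groups generated by finitely many commutators\<close>

text \<open>On \<open>A\<close>, \<open>g\<close> factors through \<open>f\<close>, so
  \<open>g\<close> A\<open>is an image of\<close>f \<open>A\<close>. Both steps of the walk use it:
  \<open>f\<close> collects the data known to take finitely many values.\<close>

lemma finite_image_factor:
  assumes "finite (f ` A)" "\<And>x y. x \<in> A \<Longrightarrow> y \<in> A \<Longrightarrow> f x = f y \<Longrightarrow> g x = g y"
  shows "finite (g ` A)"
proof -
  have "g ` A \<subseteq> (\<lambda>v. g (inv_into A f v)) ` f ` A"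
  proof
    fix v assume "v \<in> g ` A"
    then obtain x where x: "x \<in> A" "v = g x" by blast
    have "g (inv_into A f (f x)) = g x"
      using x(1) by (intro assms(2) inv_into_into f_inv_into_f) auto
    with x show "v \<in> (\<lambda>v. g (inv_into A f v)) ` f ` A" by (metis imageI)
  qed
  then show ?thesis using assms(1) finite_surj by blast
qed

context group
begin

lemma cancel_inv_left:
  assumes "x \<in> carrier G" "y \<in> carrier G"
  shows "inv x \<otimes> (x \<otimes> y) = y" "x \<otimes> (inv x \<otimes> y) = y"
  using assms by (simp_all flip: m_assoc)

lemmas cancel_simps = m_assoc inv_mult_group cancel_inv_left

lemma conj_pow:
  assumes "g \<in> carrier G" "x \<in> carrier G"
  shows "(g \<otimes> x \<otimes> inv g) [^] (n::nat) = g \<otimes> x [^] n \<otimes> inv g"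
  using assms by (induction n) (simp_all add: cancel_simps)

section \<open>Words over a conjugation-invariant set\<close>

abbreviation word :: "'a list \<Rightarrow> 'a" where
  "word ws \<equiv> foldr (\<otimes>) ws \<one>"

lemma word_closed: "set ws \<subseteq> carrier G \<Longrightarrow> word ws \<in> carrier G"
  by (induction ws) auto

lemma word_append:
  "set us \<subseteq> carrier G \<Longrightarrow> set vs \<subseteq> carrier G \<Longrightarrow> word (us @ vs) = word us \<otimes> word vs"
  by (induction us) (auto simp: m_assoc word_closed)

lemma word_replicate: "x \<in> carrier G \<Longrightarrow> word (replicate n x) = x [^] n"
  proof (induction n)
  case (Suc n)
  then show ?case using nat_pow_Suc2[of x n] by simp
qed simp

text \<open>Closure under inverses makes positive words sufficient, so that counting letters
  controls the generated group.\<close>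

lemma generate_eq_words:
  assumes C: "C \<subseteq> carrier G" and inv_C: "\<And>c. c \<in> C \<Longrightarrow> inv c \<in> C"
  shows "generate G C = word ` {ws. set ws \<subseteq> C}"
proof
  show "generate G C \<subseteq> word ` {ws. set ws \<subseteq> C}"
  proof
    fix x assume "x \<in> generate G C"
    then show "x \<in> word ` {ws. set ws \<subseteq> C}"
    proof induction
      case one
      then show ?case by (intro image_eqI[of _ _ "[]"]) auto
    next
      case (incl h)
      then show ?case using C by (intro image_eqI[of _ _ "[h]"]) auto
    next
      case (inv h)
      then show ?case using C inv_C by (intro image_eqI[of _ _ "[inv h]"]) auto
    next
      case (eng h1 h2)
      then obtain us vs where "h1 = word us" "h2 = word vs" "set us \<subseteq> C" "set vs \<subseteq> C" by blast
      then show ?case using C by (intro image_eqI[of _ _ "us @ vs"]) (auto simp: word_append simp del: foldr_append)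
    qed
  qed
  have "word ws \<in> generate G C" if ws: "set ws \<subseteq> C" for ws
    using that by (induction ws) (auto intro: generate.intros)
  then show "word ` {ws. set ws \<subseteq> C} \<subseteq> generate G C" by blast
qed

text \<open>Moving a power of \<open>c\<close> to the left across a letter only conjugates that
  letter, which stays in \<open>C\<close>. The number of letters therefore does not change.\<close>

lemma collect_letter:
  assumes C: "C \<subseteq> carrier G" and conj_C: "\<And>c g. c \<in> C \<Longrightarrow> g \<in> carrier G \<Longrightarrow> g \<otimes> c \<otimes> inv g \<in> C"
    and c: "c \<in> C" and ws: "set ws \<subseteq> C"
  shows "\<exists>vs. set vs \<subseteq> C \<and> length vs + count_list ws c = length ws
           \<and> word ws = c [^] count_list ws c \<otimes> word vs"
  using ws
proof (induction ws)
  case (Cons d ws)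
  then obtain vs where vs: "set vs \<subseteq> C" "length vs + count_list ws c = length ws"
    "word ws = c [^] count_list ws c \<otimes> word vs" by auto
  have cl: "c \<in> carrier G" "d \<in> carrier G" "word vs \<in> carrier G"
    using C c Cons.prems vs(1) word_closed by auto
  show ?case
  proof (cases "d = c")
    case True
    have "word (d # ws) = c [^] Suc (count_list ws c) \<otimes> word vs"
      unfolding nat_pow_Suc2[OF cl(1)] using cl True vs(3) by (simp add: m_assoc)
    then show ?thesis using vs(1,2) True by (intro exI[of _ vs]) auto
  next
    case False
    \<comment> \<open>The copies of \<open>c\<close> already collected; \<open>d\<close> passes them
      by \<open>d q = q (q^-1 d q)\<close>.\<close>
    define q where "q = c [^] count_list ws c"
    have q: "q \<in> carrier G" using cl by (simp add: q_def)
    have "inv q \<otimes> d \<otimes> inv (inv q) \<in> C"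
      using conj_C[of d "inv q"] Cons.prems q by (simp del: inv_inv)
    moreover have "word (d # ws) = q \<otimes> (inv q \<otimes> d \<otimes> inv (inv q) \<otimes> word vs)"
      using cl q vs(3) by (simp add: cancel_simps q_def[symmetric])
    ultimately show ?thesis using vs(1,2) False
      by (intro exI[of _ "(inv q \<otimes> d \<otimes> inv (inv q)) # vs"]) (auto simp: q_def)
  qed
qed simp

text \<open>
  A word of length exceeding \<open>card C * a\<close> contains some letter more than \<open>a\<close> times; these
  occurrences can be collected in front, where \<open>Suc a\<close> of them are replaced by only \<open>a\<close> letters.
\<close>

lemma finite_generate_if_powers_shorten:
  assumes "finite C" and C: "C \<subseteq> carrier G" and inv_C: "\<And>c. c \<in> C \<Longrightarrow> inv c \<in> C"
    and conj_C: "\<And>c g. c \<in> C \<Longrightarrow> g \<in> carrier G \<Longrightarrow> g \<otimes> c \<otimes> inv g \<in> C"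
    and short: "\<And>c. c \<in> C \<Longrightarrow> \<exists>ws. set ws \<subseteq> C \<and> length ws = a \<and> c [^] Suc a = word ws"
  shows "finite (generate G C)"
proof -
  let ?L = "card C * a"
  have bounded: "\<exists>vs. set vs \<subseteq> C \<and> length vs \<le> ?L \<and> word vs = word ws" if ws: "set ws \<subseteq> C" for ws
    using that
  proof (induction ws rule: length_induct)
    case (1 ws)
    show ?case
    proof (cases "length ws \<le> ?L")
      case True
      then show ?thesis using 1 by blast
    next
      case False
      \<comment> \<open>Pigeonhole: the occurrences of the letters of \<open>C\<close> add up to the
        length of \<open>ws\<close>.\<close>
      have "\<exists>c\<in>C. a < count_list ws c"
      proof (rule ccontr)
        assume "\<not> ?thesis"
        then have "sum (count_list ws) C \<le> card C * a"
          using sum_bounded_above[of C "count_list ws" a] by (auto simp: not_less)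
        then show False using False sum_count_set[OF _ \<open>finite C\<close>] 1(2) by simp
      qed
      then obtain c where c: "c \<in> C" "a < count_list ws c" by blast
      obtain vs where vs: "set vs \<subseteq> C" "length vs + count_list ws c = length ws"
        "word ws = c [^] count_list ws c \<otimes> word vs"
        using collect_letter[OF C conj_C c(1)] 1(2) by blast
      obtain us where us: "set us \<subseteq> C" "length us = a" "c [^] Suc a = word us"
        using short c(1) by blast
      define r where "r = count_list ws c - Suc a"
      have count: "count_list ws c = Suc a + r" using c(2) by (simp add: r_def)
      have cl: "c \<in> carrier G" "set us \<subseteq> carrier G" "set vs \<subseteq> carrier G"
        using C c us vs by auto
      let ?ws = "us @ replicate r c @ vs"
      have rep: "set (replicate r c) \<subseteq> C" using c(1) by auto
      have "c [^] count_list ws c = word us \<otimes> c [^] r"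
        unfolding count us(3)[symmetric] using cl(1) by (rule nat_pow_mult[symmetric])
      then have "word ?ws = word ws"
        using cl vs(3) rep C by (auto simp: word_append word_replicate m_assoc word_closed
            simp del: foldr_append foldr_replicate)
      moreover have "set ?ws \<subseteq> C" using us vs rep by auto
      moreover have "length ?ws < length ws" using us vs count by simp
      ultimately show ?thesis using 1(1)[rule_format, of ?ws] by simp
    qed
  qed
  have "word ws \<in> word ` {ws. set ws \<subseteq> C \<and> length ws \<le> ?L}" if ws: "set ws \<subseteq> C" for ws
  proof -
    obtain vs where vs: "set vs \<subseteq> C" "length vs \<le> ?L" "word vs = word ws"
      using bounded[OF ws] by blast
    then show ?thesis by (intro image_eqI[of _ _ vs]) simp_all
  qed
  then have "generate G C \<subseteq> word ` {ws. set ws \<subseteq> C \<and> length ws \<le> ?L}"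
    using generate_eq_words[OF C inv_C] by auto
  then show ?thesis
    using finite_lists_length_le[OF \<open>finite C\<close>] finite_surj by blast
qed

lemma center_subgroup: "subgroup (center G) G"
proof (rule subgroupI)
  fix a assume "a \<in> center G"
  then have a: "a \<in> carrier G" and comm: "\<And>x. x \<in> carrier G \<Longrightarrow> a \<otimes> x = x \<otimes> a"
    by (auto simp: center_def)
  have "inv a \<otimes> x = x \<otimes> inv a" if "x \<in> carrier G" for x
  proof -
    have "inv a \<otimes> x = inv a \<otimes> (x \<otimes> a) \<otimes> inv a" using a that by (simp add: cancel_simps)
    also have "\<dots> = x \<otimes> inv a" unfolding comm[OF that, symmetric] using a that by (simp add: cancel_simps)
    finally show ?thesis .
  qed
  then show "inv a \<in> center G" using a by (simp add: center_def)
next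
  fix a b assume "a \<in> center G" "b \<in> center G"
  then have ab: "a \<in> carrier G" "b \<in> carrier G"
    and comm: "\<And>x. x \<in> carrier G \<Longrightarrow> a \<otimes> x = x \<otimes> a" "\<And>x. x \<in> carrier G \<Longrightarrow> b \<otimes> x = x \<otimes> b"
    by (auto simp: center_def)
  have "a \<otimes> b \<otimes> x = x \<otimes> (a \<otimes> b)" if x: "x \<in> carrier G" for x
    using comm(1)[OF x] comm(2)[OF x] ab x by (metis m_assoc)
  then show "a \<otimes> b \<in> center G" using ab by (simp add: center_def)
qed (auto simp: center_def)

lemma center_pow: "z \<in> center G \<Longrightarrow> z [^] (n::nat) \<in> center G"
  by (induction n)
    (auto intro: subgroup.one_closed[OF center_subgroup] subgroup.m_closed[OF center_subgroup])

section \<open>Commutators with first entry in a normal subgroup\<close>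

abbreviation commutator :: "'a \<Rightarrow> 'a \<Rightarrow> 'a" where
  "commutator x y \<equiv> x \<otimes> y \<otimes> inv x \<otimes> inv y"

definition commutators :: "'a set \<Rightarrow> 'a set" where
  "commutators H = (\<Union>h\<in>H. \<Union>g\<in>carrier G. {commutator h g})"

lemma commutatorsE:
  assumes "c \<in> commutators H"
  obtains h g where "h \<in> H" "g \<in> carrier G" "c = commutator h g"
  using assms by (auto simp: commutators_def)

lemma commutatorsI: "h \<in> H \<Longrightarrow> g \<in> carrier G \<Longrightarrow> commutator h g \<in> commutators H"
  by (auto simp: commutators_def)

lemma commutators_conj_closed:
  assumes H: "H \<lhd> G" and c: "c \<in> commutators H" and g: "g \<in> carrier G"
  shows "g \<otimes> c \<otimes> inv g \<in> commutators H"
proof -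
  obtain h k where hk: "h \<in> H" "k \<in> carrier G" "c = commutator h k" using c by (rule commutatorsE)
  have h: "h \<in> carrier G" using subgroup.mem_carrier[OF normal_imp_subgroup[OF H] hk(1)] .
  have "g \<otimes> h \<otimes> inv g \<in> H" using normal.inv_op_closed2[OF H g hk(1)] .
  moreover have "g \<otimes> c \<otimes> inv g = commutator (g \<otimes> h \<otimes> inv g) (g \<otimes> k \<otimes> inv g)"
    using hk(2,3) h g by (simp add: cancel_simps)
  ultimately show ?thesis using hk(2) g commutatorsI by (metis inv_closed m_closed)
qed

text \<open>The inverse of \<open>[h,k]\<close> is \<open>[k,h]\<close>, whose entries are in the
  wrong order; rewriting it as \<open>[k h k^-1, k^-1]\<close> puts an element of \<open>H\<close>
  first.\<close>

lemma commutators_inv_closed: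
  assumes H: "H \<lhd> G" and c: "c \<in> commutators H"
  shows "inv c \<in> commutators H"
proof -
  obtain h k where hk: "h \<in> H" "k \<in> carrier G" "c = commutator h k" using c by (rule commutatorsE)
  have h: "h \<in> carrier G" using subgroup.mem_carrier[OF normal_imp_subgroup[OF H] hk(1)] .
  have "k \<otimes> h \<otimes> inv k \<in> H" using normal.inv_op_closed2[OF H hk(2,1)] .
  moreover have "inv c = commutator (k \<otimes> h \<otimes> inv k) (inv k)"
    using hk(2,3) h by (simp add: cancel_simps)
  ultimately show ?thesis using hk(2) commutatorsI by (metis inv_closed)
qed

lemma commutators_subset:
  assumes H: "H \<lhd> G"
  shows "commutators H \<subseteq> H"
proof
  fix c assume "c \<in> commutators H"
  then obtain h k where hk: "h \<in> H" "k \<in> carrier G" "c = commutator h k" by (rule commutatorsE)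
  have sub: "subgroup H G" using H by (rule normal_imp_subgroup)
  have h: "h \<in> carrier G" using subgroup.mem_carrier[OF sub hk(1)] .
  have "c = h \<otimes> (k \<otimes> inv h \<otimes> inv k)" using hk h by (simp add: cancel_simps)
  moreover have "k \<otimes> inv h \<otimes> inv k \<in> H"
    using normal.inv_op_closed2[OF H hk(2) subgroup.m_inv_closed[OF sub hk(1)]] .
  ultimately show "c \<in> H" using hk(1) subgroup.m_closed[OF sub] by simp
qed

text \<open>The identity behind Schur's theorem: the left side is a product of \<open>m + 2\<close>
  commutators, the right side one of only \<open>m + 1\<close>.\<close>

lemma commutator_power_shorten:
  assumes h: "h \<in> carrier G" and k: "k \<in> carrier G"
    and central: "commutator h k [^] Suc m \<in> center G"
  shows "commutator h k [^] Suc (Suc m)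
     = (h \<otimes> commutator h k \<otimes> inv h) [^] m \<otimes> commutator (h \<otimes> h) k"
proof -
  define c where "c = commutator h k"
  have c: "c \<in> carrier G" using h k by (simp add: c_def)
  have "c [^] Suc (Suc m) = c [^] Suc m \<otimes> h \<otimes> (k \<otimes> inv h \<otimes> inv k)"
  proof -
    have "c [^] Suc m \<otimes> c = c [^] Suc m \<otimes> (h \<otimes> (k \<otimes> inv h \<otimes> inv k))"
      using h k by (simp add: c_def m_assoc)
    then show ?thesis
      using h k c by (simp add: m_assoc)
  qed
  \<comment> \<open>Centrality of the power lets \<open>h\<close> move to the front, where it will
    conjugate \<open>c [^] m\<close>.\<close>
  also have "\<dots> = h \<otimes> c [^] Suc m \<otimes> (k \<otimes> inv h \<otimes> inv k)"
    using central h unfolding c_def center_def by simp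
  also have "\<dots> = h \<otimes> c [^] m \<otimes> (c \<otimes> (k \<otimes> inv h \<otimes> inv k))"
    using h k c by (simp add: m_assoc)
  also have "c \<otimes> (k \<otimes> inv h \<otimes> inv k) = inv h \<otimes> commutator (h \<otimes> h) k"
    using h k by (simp add: c_def cancel_simps)
  also have "h \<otimes> c [^] m \<otimes> \<dots> = (h \<otimes> c [^] m \<otimes> inv h) \<otimes> commutator (h \<otimes> h) k"
    using h k c by (simp add: cancel_simps)
  finally show ?thesis using h c by (simp add: c_def conj_pow)
qed

lemma finite_generate_commutators:
  assumes H: "H \<lhd> G" and fin: "finite (commutators H)"
    and pow: "\<And>c. c \<in> commutators H \<Longrightarrow> \<exists>n::nat>0. c [^] n \<in> center G"
  shows "finite (generate G (commutators H))"
proof -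
  let ?C = "commutators H"
  have sub: "subgroup H G" using H by (rule normal_imp_subgroup)
  have C: "?C \<subseteq> carrier G" using commutators_subset[OF H] subgroup.subset[OF sub] by blast
  obtain e where e: "\<And>c. c \<in> ?C \<Longrightarrow> e c > (0::nat) \<and> c [^] e c \<in> center G"
    using pow by metis
  \<comment> \<open>The product of the individual exponents is a common exponent for all of the
    finitely many commutators; positivity lets it be written \<open>Suc m\<close>.\<close>
  have "(\<Prod>c\<in>?C. e c) > 0" using e by (intro prod_pos) blast
  then obtain m where m: "(\<Prod>c\<in>?C. e c) = Suc m" using gr0_conv_Suc by blast
  have central: "c [^] Suc m \<in> center G" if "c \<in> ?C" for c
  proof -
    have "e c dvd Suc m" unfolding m[symmetric] using fin that by (rule dvd_prodI)
    then obtain r where r: "Suc m = e c * r" by blast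
    have "(c [^] e c) [^] r \<in> center G" using e[OF that] center_pow by blast
    then show ?thesis using C that unfolding r by (subst (asm) nat_pow_pow) blast+
  qed
  show ?thesis
  proof (rule finite_generate_if_powers_shorten[where a = "Suc m", OF fin C])
    fix c assume c: "c \<in> ?C"
    obtain h k where hk: "h \<in> H" "k \<in> carrier G" "c = commutator h k" using c by (rule commutatorsE)
    have h: "h \<in> carrier G" using subgroup.mem_carrier[OF sub hk(1)] .
    let ?d = "h \<otimes> c \<otimes> inv h"
    have d: "?d \<in> ?C" using commutators_conj_closed[OF H c h] .
    \<comment> \<open>The shortened power consists of \<open>m\<close> conjugates of
      \<open>c\<close> and this one commutator, hence of \<open>Suc m\<close> letters.\<close>
    have hh: "commutator (h \<otimes> h) k \<in> ?C" using hk subgroup.m_closed[OF sub] by (intro commutatorsI)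
    have "c [^] Suc (Suc m) = word (replicate m ?d @ [commutator (h \<otimes> h) k])"
      using commutator_power_shorten[OF h hk(2)] central[OF c] hk d hh C h
      by (subst word_append) (auto simp: word_replicate simp del: foldr_replicate)
    moreover have "set (replicate m ?d @ [commutator (h \<otimes> h) k]) \<subseteq> ?C"
      using d hh by auto
    moreover have "length (replicate m ?d @ [commutator (h \<otimes> h) k]) = Suc m" by simp
    ultimately show "\<exists>ws. set ws \<subseteq> ?C \<and> length ws = Suc m \<and> c [^] Suc (Suc m) = word ws"
      by blast
  qed (fact commutators_inv_closed[OF H] commutators_conj_closed[OF H])+
qed

end

section \<open>Central series\<close>

lemma (in group_hom) normal_preimage:
  assumes "K \<lhd> H"
  shows "{x \<in> carrier G. h x \<in> K} \<lhd> G"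
proof -
  interpret K: normal K H by fact
  have "subgroup {x \<in> carrier G. h x \<in> K} G"
    by (rule G.subgroupI) (auto intro: exI[of _ "\<one>\<^bsub>G\<^esub>"])
  then show ?thesis
    unfolding G.normal_inv_iff by (auto simp: K.inv_op_closed2)
qed

text \<open>Agreement of two homomorphisms need only be checked on generators. Below, the
  homomorphisms are conjugations followed by a projection, or the projection itself.\<close>

lemma (in group) subgroup_eq_hom:
  assumes "group_hom G Q f" "group_hom G Q g"
  shows "subgroup {x \<in> carrier G. f x = g x} G"
proof -
  interpret f: group_hom G Q f by fact
  interpret g: group_hom G Q g by fact
  show ?thesis by (rule subgroupI) (auto intro: exI[of _ "\<one>"])
qed

lemma (in group) conj_group_hom:
  assumes "x \<in> carrier G"
  shows "group_hom G G (\<lambda>g. x \<otimes> g \<otimes> inv x)"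
  by unfold_locales (use assms in \<open>auto simp: hom_def cancel_simps\<close>)

lemma (in normal) coset_group_hom: "group_hom G (G Mod H) (\<lambda>x. H #> x)"
  by (intro group_hom.intro is_group factorgroup_is_group group_hom_axioms.intro r_coset_hom_Mod)

lemma (in group) rcos_eq_iff:
  assumes "subgroup N G" "x \<in> carrier G" "y \<in> carrier G"
  shows "N #> x = N #> y \<longleftrightarrow> x \<otimes> inv y \<in> N"
  using assms by (metis is_group repr_independence repr_independenceD subgroup.rcos_module)

lemma (in group) center_normal: "center G \<lhd> G"
  unfolding normal_inv_iff
proof (intro conjI ballI center_subgroup)
  fix x z assume xz: "x \<in> carrier G" "z \<in> center G"
  then have "x \<otimes> z = z \<otimes> x" "z \<in> carrier G" by (auto simp: center_def)
  then have "x \<otimes> z \<otimes> inv x = z" using xz(1) by (simp add: cancel_simps)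
  then show "x \<otimes> z \<otimes> inv x \<in> center G" using xz(2) by simp
qed

lemma (in group) upper_central_normal: "upper_central G k \<lhd> G"
proof (induction k)
  case 0
  show ?case by (simp add: one_is_normal)
next
  case (Suc k)
  interpret Z: normal "upper_central G k" G by fact
  interpret \<phi>: group_hom G "G Mod upper_central G k" "\<lambda>x. upper_central G k #> x"
    by (rule Z.coset_group_hom)
  show ?case by (simp add: \<phi>.normal_preimage \<phi>.H.center_normal)
qed

lemma (in group) lower_central_Suc_Suc:
  "lower_central G (Suc (Suc n)) = generate G (commutators (lower_central G (Suc n)))"
  by (simp add: commutator_subgroup_def commutators_def)

lemma (in group) lower_central_normal: "lower_central G (Suc n) \<lhd> G"
proof (induction n)
  case 0
  show ?case by (simp add: normal_self)
next
  case (Suc n)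
  then show ?case
    unfolding lower_central_Suc_Suc
    using commutators_subset subgroup.subset[OF normal_imp_subgroup] commutators_conj_closed
    by (intro normal_generateI) blast+
qed

text \<open>The central \<open>u\<close> cancels against its inverse, and \<open>v\<close> has to
  pass only the conjugate \<open>w\<close> of \<open>inv x\<close>. The hypothesis on
  \<open>v\<close> is this weak because in the applications \<open>v\<close> commutes with the image
  of a term of the lower central series but need not be central.\<close>

lemma (in group) commutator_mult_central:
  assumes cl: "u \<in> carrier G" "x \<in> carrier G" "v \<in> carrier G" "g \<in> carrier G"
    and u: "u \<in> center G"
    and v: "v \<otimes> (g \<otimes> inv x \<otimes> inv g) = (g \<otimes> inv x \<otimes> inv g) \<otimes> v"
  shows "commutator (u \<otimes> x) (v \<otimes> g) = commutator x g"
proof -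
  define w where "w = g \<otimes> inv x \<otimes> inv g"
  have w: "w \<in> carrier G" using cl by (simp add: w_def)
  have "commutator (u \<otimes> x) (v \<otimes> g) = u \<otimes> (x \<otimes> v \<otimes> g \<otimes> inv x) \<otimes> inv u \<otimes> inv g \<otimes> inv v"
    using cl by (simp add: cancel_simps)
  also have "u \<otimes> (x \<otimes> v \<otimes> g \<otimes> inv x) = x \<otimes> v \<otimes> g \<otimes> inv x \<otimes> u"
    using u cl by (simp add: center_def)
  also have "x \<otimes> v \<otimes> g \<otimes> inv x \<otimes> u \<otimes> inv u \<otimes> inv g \<otimes> inv v = x \<otimes> (v \<otimes> w) \<otimes> inv v"
    using cl by (simp add: cancel_simps w_def)
  also have "v \<otimes> w = w \<otimes> v" using v by (simp add: w_def)
  also have "x \<otimes> (w \<otimes> v) \<otimes> inv v = commutator x g"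
    using cl by (simp add: cancel_simps w_def)
  finally show ?thesis .
qed

section \<open>The quotient by a term of the upper central series\<close>

locale upper_quotient = group G for G (structure) + fixes k :: nat
begin

abbreviation Q where "Q \<equiv> G Mod upper_central G k"
abbreviation \<phi> where "\<phi> \<equiv> \<lambda>x. upper_central G k #> x"

sublocale Z: normal "upper_central G k" G by (rule upper_central_normal)
sublocale \<phi>: group_hom G Q \<phi> by (rule Z.coset_group_hom)

lemma surj: "carrier Q = \<phi> ` carrier G"
  by (rule carrier_FactGroup)

lemma upper_central_iff: "x \<in> upper_central G (Suc k) \<longleftrightarrow> x \<in> carrier G \<and> \<phi> x \<in> center Q"
  by simp

lemma commutator_upper_central:
  assumes "x \<in> carrier G" "y \<in> carrier G" "\<phi> (x \<otimes> y) = \<phi> (y \<otimes> x)"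
  shows "commutator x y \<in> upper_central G k"
  using assms rcos_eq_iff[OF Z.subgroup_axioms, of "x \<otimes> y" "y \<otimes> x"] by (simp add: cancel_simps)

lemma hom_commutator:
  "x \<in> carrier G \<Longrightarrow> y \<in> carrier G \<Longrightarrow> \<phi> (commutator x y) = \<phi>.H.commutator (\<phi> x) (\<phi> y)"
  by simp

end

declare upper_central.simps(2) [simp del] lower_central.simps(3) [simp del]

lemma (in group) upper_central_closed: "z \<in> upper_central G k \<Longrightarrow> z \<in> carrier G"
  using subgroup.mem_carrier[OF normal_imp_subgroup[OF upper_central_normal]] .
lemma (in group) lower_central_closed: "z \<in> lower_central G (Suc k) \<Longrightarrow> z \<in> carrier G"
  using subgroup.mem_carrier[OF normal_imp_subgroup[OF lower_central_normal]] .

lemma (in upper_quotient) conj_mod_group_hom: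
  assumes "x \<in> carrier G"
  shows "group_hom G Q (\<lambda>g. \<phi> (x \<otimes> g \<otimes> inv x))"
  using Group.hom_compose[OF group_hom.homh[OF conj_group_hom[OF assms]] \<phi>.homh]
  by (intro group_hom.intro is_group \<phi>.H.is_group group_hom_axioms.intro) (simp add: comp_def)

text \<open>
  The inclusion $[\gamma_j,Z_{j+k}]\le Z_k$ with $j=n+1$. The induction step replaces the three subgroups
  lemma by the computation $z[x,g]z^{-1}=[ux,vg]$ with $u=[z,x]$ and $v=[z,g]$.
\<close>

lemma (in group) lower_upper_central_commute:
  assumes "z \<in> upper_central G (Suc (n + k))" "x \<in> lower_central G (Suc n)"
  shows "upper_central G k #> (z \<otimes> x) = upper_central G k #> (x \<otimes> z)"
  using assms
proof (induction n arbitrary: k z x)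
  case 0
  interpret upper_quotient G k ..
  show ?case using 0 by (auto simp: upper_central_iff center_def)
next
  case (Suc n)
  interpret upper_quotient G k ..
  interpret U: upper_quotient G "Suc k" ..
  interpret V: upper_quotient G "Suc (n + k)" ..
  let ?\<gamma> = "lower_central G (Suc n)"
  interpret \<gamma>: normal ?\<gamma> G by (rule lower_central_normal)
  have z: "z \<in> carrier G" using upper_central_closed[OF Suc.prems(1)] .
  have zV: "V.\<phi> z \<in> center V.Q"
    using Suc.prems(1) V.upper_central_iff by simp
  have C: "commutators ?\<gamma> \<subseteq> carrier G"
    using commutators_subset[OF \<gamma>.normal_axioms] \<gamma>.subset by blast
  \<comment> \<open>The elements that \<open>z\<close> centralizes modulo \<open>Z_k\<close>. They
    form a subgroup, so the generating commutators of the next lower central term suffice.\<close>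
  let ?M = "{c \<in> carrier G. \<phi> (z \<otimes> c \<otimes> inv z) = \<phi> c}"
  have M: "subgroup ?M G"
    by (rule subgroup_eq_hom[OF conj_mod_group_hom[OF z] \<phi>.group_hom_axioms])
  have "commutators ?\<gamma> \<subseteq> ?M"
  proof
    fix c assume c: "c \<in> commutators ?\<gamma>"
    then obtain x g where xg: "x \<in> ?\<gamma>" "g \<in> carrier G" "c = commutator x g"
      by (rule commutatorsE)
    have x: "x \<in> carrier G" using lower_central_closed[OF xg(1)] .
    define u where "u = commutator z x"
    define v where "v = commutator z g"
    have cl: "u \<in> carrier G" "v \<in> carrier G" using z x xg(2) by (simp_all add: u_def v_def)
    \<comment> \<open>First use of the induction hypothesis, one level higher: \<open>z\<close> lies
      in \<open>Z_(n+(k+1)+1)\<close>, so it commutes with \<open>x\<close> modulo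
      \<open>Z_(k+1)\<close>.\<close>
    have u: "u \<in> upper_central G (Suc k)"
      unfolding u_def using z x Suc.IH[of z "Suc k" x] Suc.prems(1) xg(1)
      by (intro U.commutator_upper_central) simp_all
    \<comment> \<open>Here \<open>z\<close> is central modulo \<open>Z_(n+k+1)\<close>. This puts
      \<open>v\<close> in range of the second use of the induction hypothesis, at level
      \<open>k\<close>, against the conjugate of \<open>inv x\<close>.\<close>
    have v: "v \<in> upper_central G (Suc (n + k))"
      unfolding v_def using z xg(2) zV
      by (intro V.commutator_upper_central) (auto simp: center_def)
    have w: "g \<otimes> inv x \<otimes> inv g \<in> ?\<gamma>" using xg(1,2) \<gamma>.inv_op_closed2 by simp
    have "z \<otimes> c \<otimes> inv z = commutator (u \<otimes> x) (v \<otimes> g)"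
      using z x xg(2) by (simp add: u_def v_def xg(3) cancel_simps)
    then have "\<phi> (z \<otimes> c \<otimes> inv z) = \<phi>.H.commutator (\<phi> u \<otimes>\<^bsub>Q\<^esub> \<phi> x) (\<phi> v \<otimes>\<^bsub>Q\<^esub> \<phi> g)"
      using cl x xg(2) by (simp add: hom_commutator)
    also have "\<dots> = \<phi>.H.commutator (\<phi> x) (\<phi> g)"
    proof (rule \<phi>.H.commutator_mult_central)
      show "\<phi> u \<in> center Q" using u upper_central_iff by blast
      show "\<phi> v \<otimes>\<^bsub>Q\<^esub> (\<phi> g \<otimes>\<^bsub>Q\<^esub> inv\<^bsub>Q\<^esub> \<phi> x \<otimes>\<^bsub>Q\<^esub> inv\<^bsub>Q\<^esub> \<phi> g)
          = \<phi> g \<otimes>\<^bsub>Q\<^esub> inv\<^bsub>Q\<^esub> \<phi> x \<otimes>\<^bsub>Q\<^esub> inv\<^bsub>Q\<^esub> \<phi> g \<otimes>\<^bsub>Q\<^esub> \<phi> v"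
        using Suc.IH[OF v w] cl x xg(2) by simp
    qed (use cl x xg(2) in simp_all)
    also have "\<dots> = \<phi> c" using x xg(2,3) by (simp add: hom_commutator)
    finally show "c \<in> ?M" using c C by auto
  qed
  then have "lower_central G (Suc (Suc n)) \<subseteq> ?M"
    unfolding lower_central_Suc_Suc using M by (rule generate_subgroup_incl)
  then have x: "x \<in> carrier G" "\<phi> (z \<otimes> x \<otimes> inv z) = \<phi> x" using Suc.prems(2) by auto
  have "\<phi> (z \<otimes> x) = \<phi> (z \<otimes> x \<otimes> inv z \<otimes> z)" using x(1) z by (simp add: cancel_simps)
  also have "\<dots> = \<phi> (x \<otimes> z)" using x z by (simp only: \<phi>.hom_mult m_closed inv_closed)
  finally show ?case .
qed

section \<open>Walking along the two series\<close>

context upper_quotient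
begin

text \<open>For \<open>n = k = 0\<close> both hypotheses say that \<open>G/Z(G)\<close> is finite,
  and the conclusion is Schur's theorem.\<close>

lemma baer_step:
  assumes fin_lower: "finite ((\<lambda>x. upper_central G (Suc k) #> x) ` lower_central G (Suc n))"
    and fin_upper: "finite ((\<lambda>x. upper_central G (Suc (n + k)) #> x) ` carrier G)"
  shows "finite (\<phi> ` lower_central G (Suc (Suc n)))"
proof -
  interpret U: upper_quotient G "Suc k" ..
  interpret V: upper_quotient G "Suc (n + k)" ..
  let ?\<gamma> = "lower_central G (Suc n)"
  interpret \<gamma>: normal ?\<gamma> G by (rule lower_central_normal)
  have C: "commutators ?\<gamma> \<subseteq> ?\<gamma>" by (rule commutators_subset[OF \<gamma>.normal_axioms])
  have image: "\<phi> ` ?\<gamma> \<lhd> Q"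
    using \<gamma>.surj_hom_normal_subgroup[OF \<phi>.group_hom_axioms] surj by simp
  have comms: "\<phi>.H.commutators (\<phi> ` ?\<gamma>) = \<phi> ` commutators ?\<gamma>"
    by (auto simp: \<phi>.H.commutators_def commutators_def surj hom_commutator image_UN)
  \<comment> \<open>The two cosets of \<open>x\<close> and \<open>g\<close> determine the commutator
    modulo \<open>Z_k\<close>: changing representatives multiplies \<open>x\<close> by some
    \<open>u\<close> in \<open>Z_(k+1)\<close> and \<open>g\<close> by some \<open>v\<close> in
    \<open>Z_(n+k+1)\<close>.\<close>
  have "finite ((\<lambda>(x, g). \<phi> (commutator x g)) ` (?\<gamma> \<times> carrier G))"
  proof (rule finite_image_factor)
    show "finite ((\<lambda>(x, g). (U.\<phi> x, V.\<phi> g)) ` (?\<gamma> \<times> carrier G))"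
      by (rule finite_subset[OF _ finite_cartesian_product[OF fin_lower fin_upper]]) auto
  next
    fix p q
    assume pq: "p \<in> ?\<gamma> \<times> carrier G" "q \<in> ?\<gamma> \<times> carrier G"
      and eq: "(\<lambda>(x, g). (U.\<phi> x, V.\<phi> g)) p = (\<lambda>(x, g). (U.\<phi> x, V.\<phi> g)) q"
    obtain x g where p: "p = (x, g)" "x \<in> ?\<gamma>" "g \<in> carrier G" using pq(1) by auto
    obtain y h where q: "q = (y, h)" "y \<in> ?\<gamma>" "h \<in> carrier G" using pq(2) by auto
    have cl: "x \<in> carrier G" "y \<in> carrier G" using p q lower_central_closed by blast+
    define u where "u = x \<otimes> inv y"
    define v where "v = g \<otimes> inv h"
    have uv: "u \<in> carrier G" "v \<in> carrier G" "x = u \<otimes> y" "g = v \<otimes> h"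
      using cl p q by (simp_all add: u_def v_def cancel_simps)
    have u: "u \<in> upper_central G (Suc k)"
      using eq cl p q rcos_eq_iff[OF U.Z.subgroup_axioms] by (simp add: u_def)
    have v: "v \<in> upper_central G (Suc (n + k))"
      using eq p q rcos_eq_iff[OF V.Z.subgroup_axioms] by (simp add: v_def)
    have w: "h \<otimes> inv y \<otimes> inv h \<in> ?\<gamma>" using q \<gamma>.inv_op_closed2 by simp
    have "\<phi> (commutator x g) = \<phi>.H.commutator (\<phi> u \<otimes>\<^bsub>Q\<^esub> \<phi> y) (\<phi> v \<otimes>\<^bsub>Q\<^esub> \<phi> h)"
      using uv(1,2) cl q(3) unfolding uv(3,4) by (simp add: hom_commutator)
    also have "\<dots> = \<phi>.H.commutator (\<phi> y) (\<phi> h)"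
    proof (rule \<phi>.H.commutator_mult_central)
      show "\<phi> u \<in> center Q" using u upper_central_iff by blast
      show "\<phi> v \<otimes>\<^bsub>Q\<^esub> (\<phi> h \<otimes>\<^bsub>Q\<^esub> inv\<^bsub>Q\<^esub> \<phi> y \<otimes>\<^bsub>Q\<^esub> inv\<^bsub>Q\<^esub> \<phi> h)
          = \<phi> h \<otimes>\<^bsub>Q\<^esub> inv\<^bsub>Q\<^esub> \<phi> y \<otimes>\<^bsub>Q\<^esub> inv\<^bsub>Q\<^esub> \<phi> h \<otimes>\<^bsub>Q\<^esub> \<phi> v"
        using lower_upper_central_commute[OF v w] uv(2) cl q(3) by simp
    qed (use uv cl q in simp_all)
    also have "\<dots> = \<phi> (commutator y h)" using cl q(3) by (simp add: hom_commutator)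
    finally show "(\<lambda>(x, g). \<phi> (commutator x g)) p = (\<lambda>(x, g). \<phi> (commutator x g)) q"
      by (simp add: p q)
  qed
  moreover have "\<phi> ` commutators ?\<gamma> = (\<lambda>(x, g). \<phi> (commutator x g)) ` (?\<gamma> \<times> carrier G)"
  proof -
    have "commutators ?\<gamma> = (\<lambda>(x, g). commutator x g) ` (?\<gamma> \<times> carrier G)"
      unfolding commutators_def by fast
    then show ?thesis by (simp only: image_image case_prod_unfold)
  qed
  ultimately have "finite (\<phi>.H.commutators (\<phi> ` ?\<gamma>))" by (simp only: comms)
  moreover have "\<exists>m::nat>0. d [^]\<^bsub>Q\<^esub> m \<in> center Q" if "d \<in> \<phi>.H.commutators (\<phi> ` ?\<gamma>)" for d
  proof -
    from that[unfolded comms] obtain c where "c \<in> commutators ?\<gamma>" and d: "d = \<phi> c" by (rule imageE)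
    then have c: "c \<in> ?\<gamma>" using C subsetD by metis
    have cG: "c \<in> carrier G" using lower_central_closed[OF c] .
    \<comment> \<open>All powers of \<open>c\<close> stay in \<open>?\<gamma>\<close>, which has
      finite image modulo \<open>Z_(k+1)\<close>. Two of them therefore coincide there, and the
      difference of their exponents gives a power that is central modulo \<open>Z_k\<close>.\<close>
    have "c [^] (m::nat) \<in> ?\<gamma>" for m using c by (induction m) simp_all
    then have "range (\<lambda>m::nat. U.\<phi> (c [^] m)) \<subseteq> U.\<phi> ` ?\<gamma>" by blast
    then have "\<not> inj (\<lambda>m::nat. U.\<phi> (c [^] m))"
      using fin_lower finite_subset range_inj_infinite by blast
    then obtain a b :: nat where ab: "a < b" "U.\<phi> (c [^] a) = U.\<phi> (c [^] b)"
      unfolding inj_def by (metis linorder_neqE_nat)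
    have "c [^] b = c [^] (b - a) \<otimes> c [^] a" using ab(1) cG by (simp add: nat_pow_mult)
    then have "c [^] (b - a) = c [^] b \<otimes> inv (c [^] a)" using cG by (simp add: cancel_simps)
    also have "\<dots> \<in> upper_central G (Suc k)"
      using ab(2) cG rcos_eq_iff[OF U.Z.subgroup_axioms, of "c [^] b" "c [^] a"] by simp
    finally have "\<phi> (c [^] (b - a)) \<in> center Q" using upper_central_iff by blast
    then have "d [^]\<^bsub>Q\<^esub> (b - a) \<in> center Q" using cG unfolding d by (simp only: \<phi>.hom_nat_pow)
    then show ?thesis using ab(1) by (intro exI[of _ "b - a"]) simp
  qed
  ultimately have "finite (generate Q (\<phi>.H.commutators (\<phi> ` ?\<gamma>)))"
    using \<phi>.H.finite_generate_commutators[OF image] by blast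
  moreover have "commutators ?\<gamma> \<subseteq> carrier G" using C \<gamma>.subset by blast
  ultimately show ?thesis
    unfolding comms lower_central_Suc_Suc by (simp only: \<phi>.generate_img)
qed

lemma hall_step:
  assumes S: "finite S" "S \<subseteq> carrier G" "generate G (S \<union> center G) = carrier G"
    and fin: "finite (\<phi> ` lower_central G (Suc (Suc n)))"
  shows "finite ((\<lambda>x. upper_central G (Suc k) #> x) ` lower_central G (Suc n))"
proof (rule finite_image_factor)
  let ?\<gamma> = "lower_central G (Suc n)"
  interpret U: upper_quotient G "Suc k" ..
  \<comment> \<open>The tuple of commutators with the generators, restricted to \<open>S\<close> so
    that it lies in a finite space of extensional functions.\<close>
  let ?F = "\<lambda>x. \<lambda>s\<in>S. \<phi> (commutator x s)"
  have "?F x \<in> S \<rightarrow>\<^sub>E \<phi> ` lower_central G (Suc (Suc n))" if x: "x \<in> ?\<gamma>" for x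
  proof (rule restrict_PiE_iff[THEN iffD2], rule ballI)
    fix s assume "s \<in> S"
    then have "commutator x s \<in> commutators ?\<gamma>" using S(2) x commutatorsI subsetD by metis
    then show "\<phi> (commutator x s) \<in> \<phi> ` lower_central G (Suc (Suc n))"
      unfolding lower_central_Suc_Suc by (intro imageI generate.incl)
  qed
  then have "?F ` ?\<gamma> \<subseteq> S \<rightarrow>\<^sub>E \<phi> ` lower_central G (Suc (Suc n))"
    by (rule image_subsetI)
  then show "finite (?F ` ?\<gamma>)"
    by (rule finite_subset) (intro finite_PiE S(1) fin)
  fix x y assume xy: "x \<in> ?\<gamma>" "y \<in> ?\<gamma>" and eq: "?F x = ?F y"
  have cl: "x \<in> carrier G" "y \<in> carrier G" using xy lower_central_closed by blast+
  \<comment> \<open>The elements on which conjugation by \<open>x\<close> and by \<open>y\<close>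
    agree modulo \<open>Z_k\<close>. Equal tuples put \<open>S\<close> into it, and central elements
    are fixed by both conjugations.\<close>
  let ?M = "{g \<in> carrier G. \<phi> (x \<otimes> g \<otimes> inv x) = \<phi> (y \<otimes> g \<otimes> inv y)}"
  have M: "subgroup ?M G"
    by (rule subgroup_eq_hom[OF conj_mod_group_hom[OF cl(1)] conj_mod_group_hom[OF cl(2)]])
  have "s \<in> ?M" if s: "s \<in> S" for s
  proof -
    have sG: "s \<in> carrier G" using s S(2) by blast
    have "\<phi> (commutator x s) = \<phi> (commutator y s)" using fun_cong[OF eq, of s] s by simp
    then have "\<phi> (commutator x s \<otimes> s) = \<phi> (commutator y s \<otimes> s)" using cl sG by simp
    then show ?thesis using cl sG by (simp add: cancel_simps del: \<phi>.hom_mult)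
  qed
  moreover have "s \<in> ?M" if s: "s \<in> center G" for s
  proof -
    have sG: "s \<in> carrier G" "x \<otimes> s = s \<otimes> x" "y \<otimes> s = s \<otimes> y"
      using s cl by (auto simp: center_def)
    then have "x \<otimes> s \<otimes> inv x = s" "y \<otimes> s \<otimes> inv y = s" using cl by (simp_all add: cancel_simps)
    then show ?thesis using sG(1) by simp
  qed
  ultimately have "S \<union> center G \<subseteq> ?M" by blast
  from generate_subgroup_incl[OF this M] have "carrier G \<subseteq> ?M" by (simp only: S(3))
  then have conj_eq: "\<phi> (x \<otimes> g \<otimes> inv x) = \<phi> (y \<otimes> g \<otimes> inv y)" if "g \<in> carrier G" for g
    using that by blast
  define u where "u = x \<otimes> inv y"
  have u: "u \<in> carrier G" using cl by (simp add: u_def)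
  have "\<phi> u \<otimes>\<^bsub>Q\<^esub> \<phi> g = \<phi> g \<otimes>\<^bsub>Q\<^esub> \<phi> u" if g: "g \<in> carrier G" for g
  proof -
    \<comment> \<open>Conjugation by \<open>u\<close> is conjugation by \<open>inv y\<close>
      followed by that by \<open>x\<close>; the latter may be replaced by conjugation by
      \<open>y\<close>, which undoes the first.\<close>
    have "\<phi> (u \<otimes> g \<otimes> inv u) = \<phi> (x \<otimes> (inv y \<otimes> g \<otimes> y) \<otimes> inv x)"
      using cl g by (simp add: u_def cancel_simps del: \<phi>.hom_mult)
    also have "\<dots> = \<phi> (y \<otimes> (inv y \<otimes> g \<otimes> y) \<otimes> inv y)" using cl g by (intro conj_eq) simp
    also have "y \<otimes> (inv y \<otimes> g \<otimes> y) \<otimes> inv y = g" using cl g by (simp add: cancel_simps)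
    finally have "\<phi> (u \<otimes> g \<otimes> inv u \<otimes> u) = \<phi> (g \<otimes> u)" using u g by simp
    then have "\<phi> (u \<otimes> g) = \<phi> (g \<otimes> u)" using u g by (simp add: cancel_simps del: \<phi>.hom_mult)
    then show ?thesis using u g by simp
  qed
  then have "u \<in> upper_central G (Suc k)"
    using u unfolding upper_central_iff by (auto simp: center_def[of Q] surj)
  then show "U.\<phi> x = U.\<phi> y"
    using rcos_eq_iff[OF U.Z.subgroup_axioms cl] by (simp add: u_def)
qed

end

text \<open>Lift the generators of the quotient: every element differs by a central factor from one
  generated by the lifts.\<close>

lemma (in group) generators_mod_center:
  assumes "finitely_generated (G Mod center G)"
  obtains S where "finite S" "S \<subseteq> carrier G" "generate G (S \<union> center G) = carrier G"
proof -
  interpret Z: normal "center G" G by (rule center_normal)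
  interpret \<psi>: group_hom G "G Mod center G" "\<lambda>x. center G #> x" by (rule Z.coset_group_hom)
  let ?\<psi> = "\<lambda>x. center G #> x"
  obtain T where T: "finite T" "T \<subseteq> ?\<psi> ` carrier G" "generate (G Mod center G) T = ?\<psi> ` carrier G"
    using assms unfolding finitely_generated_def carrier_FactGroup by blast
  then obtain S where S: "finite S" "S \<subseteq> carrier G" "T = ?\<psi> ` S"
    using finite_subset_image by metis
  have gen: "?\<psi> ` generate G S = ?\<psi> ` carrier G"
    using T(3) \<psi>.generate_img[OF S(2)] S(3) by simp
  have "x \<in> generate G (S \<union> center G)" if x: "x \<in> carrier G" for x
  proof -
    obtain y where y: "y \<in> generate G S" "?\<psi> x = ?\<psi> y" using gen x by blast
    have yG: "y \<in> carrier G" using y(1) generate_in_carrier[OF S(2)] by blast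
    have "x \<otimes> inv y \<in> center G" using rcos_eq_iff[OF Z.subgroup_axioms x yG] y(2) by blast
    then have "x \<otimes> inv y \<in> generate G (S \<union> center G)" by (simp add: generate.incl)
    moreover have "y \<in> generate G (S \<union> center G)"
      using y(1) mono_generate[of S "S \<union> center G"] by blast
    ultimately have "x \<otimes> inv y \<otimes> y \<in> generate G (S \<union> center G)" by (rule generate.eng)
    then show ?thesis using x yG by (simp add: cancel_simps)
  qed
  moreover have "generate G (S \<union> center G) \<subseteq> carrier G"
    using S(2) Z.subset by (intro generate_incl) blast
  ultimately show thesis using S that by blast
qed

theorem theorem2p2:
  fixes G :: "('a, 'b) monoid_scheme" and i :: nat
  assumes "group G"
    and "finitely_generated (G Mod center G)"
    and "i \<ge> 1"
  shows "finite (lower_central G (i + 1)) \<longleftrightarrow> finite (carrier (G Mod upper_central G i))"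
proof -
  interpret group G by fact
  \<comment> \<open>The first index is shifted: \<open>P n k\<close> concerns
    \<open>gamma_(n+1)\<close>, so the walk follows the diagonal \<open>n + k = i\<close>.\<close>
  define P where "P n k \<longleftrightarrow> finite ((\<lambda>x. upper_central G k #>\<^bsub>G\<^esub> x) ` lower_central G (Suc n))" for n k
  obtain S where S: "finite S" "S \<subseteq> carrier G" "generate G (S \<union> center G) = carrier G"
    using generators_mod_center[OF assms(2)] .
  have hall: "P n k \<Longrightarrow> n + k = i \<Longrightarrow> P 0 i" for n k
  proof (induction n arbitrary: k)
    case (Suc n)
    interpret upper_quotient G k ..
    have "P n (Suc k)" using hall_step[OF S] Suc.prems(1) by (simp only: P_def)
    then show ?case using Suc by simp
  qed simp
  \<comment> \<open>The assumption \<open>P 0 i\<close> is both the starting point and, since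
    \<open>Suc (n + k) = i\<close> throughout, the second hypothesis of \<open>baer_step\<close> at
    each step.\<close>
  have baer: "P 0 i \<Longrightarrow> n + k = i \<Longrightarrow> P n k" for n k
  proof (induction n arbitrary: k)
    case (Suc n)
    interpret upper_quotient G k ..
    have "P n (Suc k)" using Suc by simp
    moreover have "Suc (n + k) = i" using Suc.prems(2) by simp
    ultimately show ?case
      using baer_step[of n] Suc.prems(1) by (simp only: P_def lower_central.simps(2))
  qed simp
  have "lower_central G (Suc i) \<subseteq> carrier G"
    using lower_central_normal normal_imp_subgroup subgroup.subset by blast
  \<comment> \<open>Cosets of \<open>Z_0\<close> are singletons, so \<open>P i 0\<close> is
    finiteness of \<open>gamma_(i+1)\<close> itself.\<close>
  then have "inj_on (\<lambda>x. upper_central G 0 #>\<^bsub>G\<^esub> x) (lower_central G (Suc i))"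
    by (auto simp: inj_on_def r_coset_def subset_iff)
  then have "finite (lower_central G (i + 1)) \<longleftrightarrow> P i 0"
    by (simp only: P_def finite_image_iff Suc_eq_plus1)
  also have "\<dots> \<longleftrightarrow> P 0 i" using hall[of i 0] baer[of i 0] by auto
  also have "\<dots> \<longleftrightarrow> finite (carrier (G Mod upper_central G i))"
    by (simp add: P_def carrier_FactGroup)
  finally show ?thesis .
qed

end
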